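(* Let $n\ge k\ge 0$ be integers. Then $$L_{n,k}(u,v,q)=\sum_{m=0}^{k}(uv)^m q^{\binom{m+1}{2}}\begin{bmatrix} n\\ m\end{bmatrix}_q\frac{(-(u/v)q^{n-m+1};q)_m}{(u^2q^{2n-m+1};q)_m},$$ where $$L_{n,k}(u,v,q)=\sum_{\lambda\in L_{n,k}}q^{|\lambda|}u^{|\lceil\lambda\rceil|}v^{o(\lceil\lambda\rceil)}$$ is the generating function of truncated lecture hall partitions.
   Context: For $n\ge k$, $L_{n,k}$ is the set of truncated lecture hall partitions: sequences $\lambda=(\lambda_1,\ldots,\lambda_k)$ of nonnegative integers with $$\frac{\lambda_1}{n}\ge\frac{\lambda_2}{n-1}\ge\cdots\ge\frac{\lambda_k}{n-k+1}\ge 0$$ (for $k=0$ the set consists of the empty sequence only). For a finite sequence $\mu$ of nonnegative integers, $|\mu|$ is the sum of its entries and $o(\mu)$ is the number of odd entries. For $\lambda\in L_{n,k}$, $\lceil\lambda\rceil=(\lceil\lambda_1/n\rceil,\lceil\lambda_2/(n-1)\rceil,\ldots,\lceil\lambda_k/(n-k+1)\rceil)$. Notation: $(a;q)_m=\prod_{i=0}^{m-1}(1-aq^i)$ and $\begin{bmatrix} n\\ m\end{bmatrix}_q=(q^{n-m+1};q)_m/(q;q)_m$ (Gaussian polynomial). Identities are between formal power series in $q$ (rational functions on the right being expanded in powers of $q$). *)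

theory Defs
  imports Complex_Main "HOL-Computational_Algebra.Formal_Power_Series"
begin

text \<open>
  Sequences are lists indexed from 0, so the entry \<open>xs ! i\<close> is the part with index \<open>i + 1\<close>, whose
  denominator is \<open>n - i\<close>; this is positive for \<open>i < k \<le> n\<close>. Since the parts are natural numbers, the
  final condition that the last ratio be nonnegative holds automatically.
\<close>

definition truncated_lecture_hall :: "nat \<Rightarrow> nat \<Rightarrow> nat list set" where
  "truncated_lecture_hall n k =
     {xs. length xs = k \<and>
         (\<forall>i. Suc i < k \<longrightarrow>
            real (xs ! i) / real (n - i) \<ge> real (xs ! Suc i) / real (n - Suc i))}"

definition ceil_seq :: "nat \<Rightarrow> nat list \<Rightarrow> nat list" where
  "ceil_seq n xs = map (\<lambda>i. nat \<lceil>real (xs ! i) / real (n - i)\<rceil>) [0..<length xs]"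

definition num_odd :: "nat list \<Rightarrow> nat" where
  "num_odd \<mu> = length (filter odd \<mu>)"

text \<open>
  The generating function as a power series in \<open>q\<close>: the coefficient of \<open>q ^ N\<close> collects the
  sequences of weight \<open>N\<close>, of which there are finitely many.
\<close>

lemma finite_truncated_lecture_hall_weight:
  "finite {xs \<in> truncated_lecture_hall n k. sum_list xs = N}"
proof (rule finite_subset)
  show "{xs \<in> truncated_lecture_hall n k. sum_list xs = N}
          \<subseteq> {xs. set xs \<subseteq> {..N} \<and> length xs = k}"
    by (auto simp: truncated_lecture_hall_def intro: member_le_sum_list)
qed (simp add: finite_lists_length_eq)

definition truncated_lecture_hall_gf :: "nat \<Rightarrow> nat \<Rightarrow> 'a::field \<Rightarrow> 'a \<Rightarrow> 'a fps" where
  "truncated_lecture_hall_gf n k u v =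
     Abs_fps (\<lambda>N. \<Sum>xs | xs \<in> truncated_lecture_hall n k \<and> sum_list xs = N.
                     u ^ sum_list (ceil_seq n xs) * v ^ num_odd (ceil_seq n xs))"

definition q_pochhammer :: "'a::comm_ring_1 \<Rightarrow> 'a \<Rightarrow> nat \<Rightarrow> 'a" where
  "q_pochhammer a q m = (\<Prod>i<m. 1 - a * q ^ i)"

text \<open>
  Used only for \<open>m \<le> n\<close>, where the subtraction is exact. At \<open>q = fps_X\<close> the denominator has constant
  coefficient 1, so the quotient is multiplication by its inverse power series.
\<close>

definition gauss_poly :: "nat \<Rightarrow> nat \<Rightarrow> 'a::field fps \<Rightarrow> 'a fps" where
  "gauss_poly n m q = q_pochhammer (q ^ (n - m + 1)) q m / q_pochhammer q q m"

end

theory Submission imports Defs begin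

text \<open>
  The nonzero entries of a truncated lecture hall partition form a prefix, so it suffices to find
  the generating function \<open>A\<^sub>k(v, w)\<close> of the sequences with exactly \<open>k\<close> entries, all positive, where
  every odd ceiling is weighted by \<open>v\<close> and every even ceiling by \<open>w\<close>. In such a sequence the entries
  of ceiling 1 form a suffix, which is an arbitrary strictly decreasing sequence in \<open>{1..n-m}\<close>, where
  \<open>m\<close> is the length of the remaining prefix; subtracting \<open>n, n-1, \<dots>\<close> from that prefix lowers all its
  ceilings by 1 and thereby exchanges \<open>v\<close> and \<open>w\<close>. This gives a recurrence expressing \<open>A\<^sub>k(v, w)\<close>
  through \<open>A\<^sub>m(w, v)\<close> for \<open>m \<le> k\<close>. Applied twice it determines \<open>A\<^sub>k\<close>, and the product formula satisfies it
  by a \<open>q\<close>-Vandermonde summation.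
\<close>

subsection \<open>q-binomial coefficients\<close>

text \<open>The exponent \<open>n - k\<close> is truncated only when \<open>n < k\<close>, where \<open>qbinom q n k = 0\<close>.\<close>

fun qbinom :: "'a::comm_ring_1 \<Rightarrow> nat \<Rightarrow> nat \<Rightarrow> 'a" where
  "qbinom q n 0 = 1"
| "qbinom q 0 (Suc k) = 0"
| "qbinom q (Suc n) (Suc k) = qbinom q n (Suc k) + q ^ (n - k) * qbinom q n k"

lemma qbinom_eq_0: "n < k \<Longrightarrow> qbinom q n k = 0"
  by (induction q n k rule: qbinom.induct) auto

text \<open>The recursion of \<open>qbinom\<close> splits row \<open>Suc k\<close> into two copies
  of row \<open>k\<close>, one of them shifted by one index. This drives the induction in
  \<open>q_vandermonde\<close>.\<close>

lemma sum_qbinom_Suc: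
  "(\<Sum>m\<le>Suc k. qbinom q (Suc k) m * c m) =
     (\<Sum>m\<le>k. qbinom q k m * (c m + q ^ (k - m) * c (Suc m)))"
proof -
  have "(\<Sum>m\<le>Suc k. qbinom q k m * c m) = (\<Sum>m\<le>k. qbinom q k m * c m)"
    by (simp add: qbinom_eq_0)
  hence "(\<Sum>m\<le>k. qbinom q k m * c m) = c 0 + (\<Sum>m\<le>k. qbinom q k (Suc m) * c (Suc m))"
    by (simp only: sum.atMost_Suc_shift) simp
  thus ?thesis
    by (simp only: sum.atMost_Suc_shift)
       (simp add: algebra_simps sum.distrib)
qed

text \<open>A q-Chu-Vandermonde sum with denominators cleared. In the induction on \<open>k\<close>,
  each pair of neighbouring terms produced by \<open>sum_qbinom_Suc\<close> collapses to
  \<open>v + u * w * q ^ a\<close> times one term for \<open>k\<close> and \<open>a - 1\<close>. The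
  induction lowers \<open>a\<close> but not \<open>b\<close>, so the two are kept apart although the
  application has both equal to \<open>n\<close>.\<close>

lemma q_vandermonde:
  fixes q u v w :: "'a::comm_ring_1"
  assumes "k \<le> a" "k \<le> b"
  shows "(\<Sum>m\<le>k. qbinom q k m *
            (v ^ (k - m) * u ^ m * q ^ (m * (a - k) + (m + 1 choose 2)) *
             (\<Prod>j<m. w + u * v * q ^ (b - j)) * (\<Prod>j\<in>{m..<k}. 1 - u\<^sup>2 * q ^ (a + b - j)))) =
         (\<Prod>j<k. v + u * w * q ^ (a - j))"
  using assms
proof (induction k arbitrary: a)
  case 0
  thus ?case by (simp add: numeral_2_eq_2)
next
  case (Suc k)
  then obtain a' where a: "a = Suc a'" "k \<le> a'" by (cases a) auto
  define c where "c k a m = v ^ (k - m) * u ^ m * q ^ (m * (a - k) + (m + 1 choose 2)) *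
             (\<Prod>j<m. w + u * v * q ^ (b - j)) * (\<Prod>j\<in>{m..<k}. 1 - u\<^sup>2 * q ^ (a + b - j))" for k a m
  \<comment> \<open>Apart from a common factor, the two terms are
    \<open>v * (1 - u\<^sup>2 * q ^ (a + b - m))\<close> and
    \<open>u * q ^ a * (w + u * v * q ^ (b - m))\<close>; on addition the parts containing
    \<open>u\<^sup>2 * v\<close> cancel.\<close>
  have step: "c (Suc k) a m + q ^ (k - m) * c (Suc k) a (Suc m) = (v + u * w * q ^ a) * c k a' m"
    if "m \<le> k" for m
  proof -
    define P where "P = (\<Prod>j<m. w + u * v * q ^ (b - j))"
    define Y where "Y = (\<Prod>j\<in>{m..<k}. 1 - u\<^sup>2 * q ^ (a' + b - j))"
    define e where "e = m * (a' - k) + (m + 1 choose 2)"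
    have Y: "(\<Prod>j\<in>{Suc m..<Suc k}. 1 - u\<^sup>2 * q ^ (a + b - j)) = Y"
      unfolding Y_def by (subst prod.shift_bounds_Suc_ivl) (simp add: a)
    have "(\<Prod>j\<in>{m..<Suc k}. 1 - u\<^sup>2 * q ^ (a + b - j)) = (1 - u\<^sup>2 * q ^ (a + b - m)) * Y"
      using that by (subst prod.atLeast_Suc_lessThan) (simp, simp only: Y)
    hence 1: "c (Suc k) a m = v ^ (k - m) * u ^ m * q ^ e * P * Y * (v * (1 - u\<^sup>2 * q ^ (a + b - m)))"
      using that by (simp add: c_def P_def e_def a Suc_diff_le mult_ac)
    define e' where "e' = Suc m * (a' - k) + (Suc m + 1 choose 2)"
    have "(k - m) + e' = e + a"
      using that a by (simp add: e_def e'_def numeral_2_eq_2)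
    hence e': "q ^ (k - m) * q ^ e' = q ^ e * q ^ a"
      by (metis power_add)
    have "c (Suc k) a (Suc m) =
          v ^ (k - m) * (u * u ^ m) * q ^ e' * (P * (w + u * v * q ^ (b - m))) * Y"
      unfolding c_def Y e'_def by (simp add: P_def a(1))
    hence "q ^ (k - m) * c (Suc k) a (Suc m) = (q ^ (k - m) * q ^ e') *
          (v ^ (k - m) * u ^ m * P * Y * (u * (w + u * v * q ^ (b - m))))"
      by (simp add: mult_ac)
    hence 2: "q ^ (k - m) * c (Suc k) a (Suc m) =
          v ^ (k - m) * u ^ m * q ^ e * P * Y * (u * q ^ a * (w + u * v * q ^ (b - m)))"
      unfolding e' by (simp add: mult_ac)
    have "a + b - m = a + (b - m)" using that Suc.prems by simp
    hence 3: "q ^ (a + b - m) = q ^ a * q ^ (b - m)" by (simp add: power_add)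
    have 4: "c k a' m = v ^ (k - m) * u ^ m * q ^ e * P * Y"
      by (simp add: c_def P_def Y_def e_def)
    show ?thesis
      unfolding 1 2 3 4
      by (simp add: algebra_simps power2_eq_square)
  qed
  have "(\<Sum>m\<le>Suc k. qbinom q (Suc k) m * c (Suc k) a m) =
        (\<Sum>m\<le>k. qbinom q k m * ((v + u * w * q ^ a) * c k a' m))"
    unfolding sum_qbinom_Suc by (intro sum.cong refl) (simp add: step)
  also have "\<dots> = (v + u * w * q ^ a) * (\<Sum>m\<le>k. qbinom q k m * c k a' m)"
    by (simp add: sum_distrib_left mult_ac)
  also have "(\<Sum>m\<le>k. qbinom q k m * c k a' m) = (\<Prod>j<k. v + u * w * q ^ (a' - j))"
    using Suc.IH[of a'] Suc.prems a by (simp add: c_def)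
  also have "(v + u * w * q ^ a) * \<dots> = (\<Prod>j<Suc k. v + u * w * q ^ (a - j))"
    by (subst prod.lessThan_Suc_shift) (simp add: a)
  finally show ?case by (simp add: c_def)
qed

section \<open>q-Pochhammer products and Gaussian polynomials\<close>

lemma q_pochhammer_0 [simp]: "q_pochhammer a q 0 = 1"
  by (simp add: q_pochhammer_def)

lemma q_pochhammer_Suc: "q_pochhammer a q (Suc m) = q_pochhammer a q m * (1 - a * q ^ m)"
  by (simp add: q_pochhammer_def)

lemma q_pochhammer_add:
  "q_pochhammer a q (m + n) = q_pochhammer a q m * q_pochhammer (a * q ^ m) q n"
  by (induction n) (simp_all add: q_pochhammer_def power_add mult_ac)

lemma qbinom_mult_pochhammer:
  "m \<le> n \<Longrightarrow> qbinom q n m * q_pochhammer q q m * q_pochhammer q q (n - m) = q_pochhammer q q n"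
proof (induction q n m rule: qbinom.induct)
  case (3 q n k)
  show ?case
  \<comment> \<open>For \<open>k = n\<close> the induction hypothesis for \<open>Suc k\<close> has a
    false premise, but the corresponding term vanishes by \<open>qbinom_eq_0\<close>.\<close>
  proof (cases "k = n")
    case True
    thus ?thesis using 3 by (simp add: qbinom_eq_0 q_pochhammer_Suc mult.assoc [symmetric])
  next
    case False
    with 3 obtain d where n: "n = Suc (k + d)" using less_imp_Suc_add[of k n] by auto
    note IH = "3.IH"[unfolded n, simplified]
    have "qbinom q (Suc n) (Suc k) * q_pochhammer q q (Suc k) * q_pochhammer q q (Suc n - Suc k) =
      (qbinom q n (Suc k) * q_pochhammer q q (Suc k) * q_pochhammer q q d) * (1 - q * q ^ d) +
      q * q ^ d * (1 - q * q ^ k) * (qbinom q n k * q_pochhammer q q k * q_pochhammer q q (Suc d))"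
      by (simp add: n q_pochhammer_Suc algebra_simps)
    also have "\<dots> = q_pochhammer q q n * ((1 - q * q ^ d) + q * q ^ d * (1 - q * q ^ k))"
      using IH by (simp add: n algebra_simps)
    also have "(1 - q * q ^ d) + q * q ^ d * (1 - q * q ^ k) = 1 - q * q ^ n"
      by (simp add: n algebra_simps power_add)
    finally show ?thesis by (simp add: q_pochhammer_Suc)
  qed
qed (simp_all add: q_pochhammer_def)

lemma q_pochhammer_nth_0:
  "fps_nth (q_pochhammer (a * fps_X) fps_X m) 0 = (1 :: 'a::comm_ring_1)"
  by (induction m) (simp_all add: q_pochhammer_def)

lemma q_pochhammer_fps_X_neq_0: "q_pochhammer fps_X fps_X m \<noteq> (0 :: 'a::field fps)"
  using q_pochhammer_nth_0[of 1 m] by (metis fps_zero_nth mult_1 zero_neq_one)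

lemma gauss_poly_eq_qbinom:
  assumes "m \<le> n"
  shows "gauss_poly n m fps_X = (qbinom fps_X n m :: 'a::field fps)"
proof -
  let ?p = "q_pochhammer (fps_X :: 'a fps) fps_X"
  have "?p (n - m) * q_pochhammer (fps_X ^ (n - m + 1)) fps_X m = ?p n"
    using q_pochhammer_add[of fps_X "fps_X :: 'a fps" "n - m" m] assms by simp
  also have "\<dots> = ?p (n - m) * (qbinom fps_X n m * ?p m)"
    using qbinom_mult_pochhammer[OF assms, of "fps_X :: 'a fps"] by (simp add: mult_ac)
  finally have "q_pochhammer (fps_X ^ (n - m + 1)) fps_X m = qbinom fps_X n m * ?p m"
    using q_pochhammer_fps_X_neq_0 mult_left_cancel by blast
  thus ?thesis
    by (simp only: gauss_poly_def nonzero_mult_div_cancel_right[OF q_pochhammer_fps_X_neq_0])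
qed

text \<open>The q-analogue of trinomial revision: both sides are
  \<open>q_pochhammer fps_X fps_X n\<close> divided by the three such products of lengths
  \<open>m\<close>, \<open>k - m\<close> and \<open>n - k\<close>.\<close>

lemma qbinom_mult:
  assumes "m \<le> k" "k \<le> n"
  shows "qbinom fps_X n m * qbinom fps_X (n - m) (k - m) =
         qbinom fps_X n k * (qbinom fps_X k m :: 'a::field fps)"
proof -
  let ?b = "qbinom (fps_X :: 'a fps)"
  let ?p = "q_pochhammer (fps_X :: 'a fps) fps_X"
  have eq: "n - m - (k - m) = n - k" using assms by simp
  note * = qbinom_mult_pochhammer[of _ _ "fps_X :: 'a fps"]
  have "(?b n m * ?b (n - m) (k - m)) * (?p m * ?p (k - m) * ?p (n - k)) =
        ?b n m * ?p m * (?b (n - m) (k - m) * ?p (k - m) * ?p (n - k))"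
    by (simp add: mult_ac)
  also have "\<dots> = ?p n" using *[of m n] *[of "k - m" "n - m"] assms by (simp add: eq)
  also have "\<dots> = ?b n k * (?b k m * ?p m * ?p (k - m)) * ?p (n - k)"
    using *[of m k] *[of k n] assms by simp
  also have "\<dots> = (?b n k * ?b k m) * (?p m * ?p (k - m) * ?p (n - k))" by (simp add: mult_ac)
  finally show ?thesis
    by (rule mult_right_cancel[THEN iffD1, rotated]) (intro no_zero_divisors q_pochhammer_fps_X_neq_0)
qed

subsection \<open>Weighted generating functions\<close>

text \<open>A sum over an infinite set is 0, so a coefficient is meaningful only if its weight class
  is finite; hence the finiteness assumptions in the union and product rules.\<close>

definition weighted_gf :: "'b set \<Rightarrow> ('b \<Rightarrow> nat) \<Rightarrow> ('b \<Rightarrow> 'a) \<Rightarrow> 'a::comm_ring_1 fps" where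
  "weighted_gf S s f = Abs_fps (\<lambda>N. \<Sum>x | x \<in> S \<and> s x = N. f x)"

lemma weighted_gf_bij_betw:
  assumes h: "bij_betw h S T"
    and "\<And>x. x \<in> S \<Longrightarrow> s x = t (h x)" "\<And>x. x \<in> S \<Longrightarrow> f x = g (h x)"
  shows "weighted_gf T t g = weighted_gf S s f"
proof -
  have "(\<Sum>y | y \<in> T \<and> t y = N. g y) = (\<Sum>x | x \<in> S \<and> s x = N. f x)" for N
  proof (rule sum.reindex_bij_betw_not_neutral[of "{}" "{}" h, simplified, THEN sym, THEN trans])
    show "bij_betw h {x \<in> S. s x = N} {y \<in> T. t y = N}"
      using assms by (auto simp: bij_betw_def inj_on_def image_iff)
  qed (auto simp: assms)
  thus ?thesis by (simp add: weighted_gf_def)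
qed

lemma weighted_gf_cong:
  assumes "\<And>x. x \<in> S \<Longrightarrow> s x = t x" "\<And>x. x \<in> S \<Longrightarrow> f x = g x"
  shows "weighted_gf S s f = weighted_gf S t g"
  using assms by (intro weighted_gf_bij_betw[symmetric, of id]) auto

lemma weighted_gf_UN:
  assumes "finite I" "\<And>i j. i \<in> I \<Longrightarrow> j \<in> I \<Longrightarrow> i \<noteq> j \<Longrightarrow> S i \<inter> S j = {}"
    and "\<And>i N. i \<in> I \<Longrightarrow> finite {x \<in> S i. s x = N}"
  shows "weighted_gf (\<Union>i\<in>I. S i) s f = (\<Sum>i\<in>I. weighted_gf (S i) s f)"
proof (rule fps_ext)
  fix N
  have "{x. x \<in> (\<Union>i\<in>I. S i) \<and> s x = N} = (\<Union>i\<in>I. {x \<in> S i. s x = N})" by auto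
  moreover have "sum f \<dots> = (\<Sum>i\<in>I. sum f {x \<in> S i. s x = N})"
    using assms by (intro sum.UNION_disjoint) blast+
  ultimately show "fps_nth (weighted_gf (\<Union>i\<in>I. S i) s f) N = fps_nth (\<Sum>i\<in>I. weighted_gf (S i) s f) N"
    by (simp add: weighted_gf_def fps_sum_nth)
qed

lemma weighted_gf_Times:
  assumes "\<And>N. finite {x \<in> S. s x = N}" "\<And>N. finite {y \<in> T. t y = N}"
  shows "weighted_gf (S \<times> T) (\<lambda>(x, y). s x + t y) (\<lambda>(x, y). f x * g y) =
         weighted_gf S s f * weighted_gf T t g"
proof (rule fps_ext)
  fix N
  let ?S = "\<lambda>i. {x \<in> S. s x = i}" and ?T = "\<lambda>i. {y \<in> T. t y = i}"
  have eq: "{p. p \<in> S \<times> T \<and> (case p of (x, y) \<Rightarrow> s x + t y) = N} = (\<Union>i\<in>{0..N}. ?S i \<times> ?T (N - i))"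
    by auto
  have "(\<Sum>p | p \<in> S \<times> T \<and> (case p of (x, y) \<Rightarrow> s x + t y) = N. case p of (x, y) \<Rightarrow> f x * g y) =
        (\<Sum>i=0..N. \<Sum>p\<in>?S i \<times> ?T (N - i). case p of (x, y) \<Rightarrow> f x * g y)"
    unfolding eq using assms by (intro sum.UNION_disjoint) auto
  also have "\<dots> = (\<Sum>i=0..N. sum f (?S i) * sum g (?T (N - i)))"
    by (simp add: sum_product sum.cartesian_product)
  finally show "fps_nth (weighted_gf (S \<times> T) (\<lambda>(x, y). s x + t y) (\<lambda>(x, y). f x * g y)) N =
      fps_nth (weighted_gf S s f * weighted_gf T t g) N"
    by (simp add: weighted_gf_def fps_mult_nth)
qed

lemma weighted_gf_shift:
  "weighted_gf S (\<lambda>x. c + s x) (\<lambda>x. a * f x) = fps_const a * fps_X ^ c * weighted_gf S s f"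
proof (rule fps_ext)
  fix N
  have "{x. x \<in> S \<and> c + s x = N} = (if N < c then {} else {x. x \<in> S \<and> s x = N - c})" by auto
  thus "fps_nth (weighted_gf S (\<lambda>x. c + s x) (\<lambda>x. a * f x)) N =
        fps_nth (fps_const a * fps_X ^ c * weighted_gf S s f) N"
    by (simp add: weighted_gf_def mult.assoc fps_X_power_mult_nth sum_distrib_left)
qed

section \<open>Lecture hall sequences and strictly decreasing sequences\<close>

text \<open>
  Agrees with the condition on ratios only for lists of length at most \<open>n\<close>, where no denominator
  vanishes.
\<close>

fun lecture_hall :: "nat \<Rightarrow> nat list \<Rightarrow> bool" where
  "lecture_hall n (x # y # ys) \<longleftrightarrow> y * n \<le> x * (n - 1) \<and> lecture_hall (n - 1) (y # ys)"
| "lecture_hall n _ \<longleftrightarrow> True"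

lemma all_less_Suc_shift: "(\<forall>i. Suc i < Suc k \<longrightarrow> P i) \<longleftrightarrow> (0 < k \<longrightarrow> P 0) \<and> (\<forall>i. Suc i < k \<longrightarrow> P (Suc i))"
  by (cases k) (simp_all add: All_less_Suc2)

lemma truncated_lecture_hall_iff:
  assumes "k \<le> n"
  shows "xs \<in> truncated_lecture_hall n k \<longleftrightarrow> length xs = k \<and> lecture_hall n xs"
  using assms
proof (induction n xs arbitrary: k rule: lecture_hall.induct)
  case (1 n x y ys)
  show ?case
  proof (cases k)
    case (Suc k')
    \<comment> \<open>With \<open>0 < k'\<close>, the assumption \<open>k \<le> n\<close> gives
      \<open>2 \<le> n\<close>, so both denominators are positive and cross-multiplication is
      valid.\<close>
    have ratio: "real x / real n \<ge> real y / real (n - 1) \<longleftrightarrow> y * n \<le> x * (n - 1)" if "0 < k'"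
    proof -
      have "real n > 0" "real (n - 1) > 0" using that 1 Suc by auto
      hence "real x / real n \<ge> real y / real (n - 1) \<longleftrightarrow> real y * real n \<le> real x * real (n - 1)"
        by (simp add: field_simps)
      also have "\<dots> \<longleftrightarrow> y * n \<le> x * (n - 1)" by (metis of_nat_le_iff of_nat_mult)
      finally show ?thesis .
    qed
    have k': "k' \<le> n - 1" using 1 Suc by simp
    have step: "x # y # ys \<in> truncated_lecture_hall n (Suc k') \<longleftrightarrow>
        (0 < k' \<longrightarrow> real x / real n \<ge> real y / real (n - 1)) \<and>
        y # ys \<in> truncated_lecture_hall (n - 1) k'"
      by (simp only: truncated_lecture_hall_def mem_Collect_eq all_less_Suc_shift) auto
    show ?thesis
      unfolding Suc step "1.IH"[OF k'] using ratio by (cases "0 < k'") auto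
  qed (simp add: truncated_lecture_hall_def)
qed (auto simp: truncated_lecture_hall_def)

definition pos_lecture_hall :: "nat \<Rightarrow> nat \<Rightarrow> nat list set" where
  "pos_lecture_hall n k = {xs. length xs = k \<and> lecture_hall n xs \<and> 0 \<notin> set xs}"

definition strict_lists :: "nat \<Rightarrow> nat \<Rightarrow> nat list set" where
  "strict_lists n k = {xs. length xs = k \<and> sorted_wrt (>) xs \<and> set xs \<subseteq> {1..n}}"

lemma finite_lists_length_sum: "finite {xs :: nat list. length xs = k \<and> sum_list xs = N}"
proof (rule finite_subset)
  show "{xs. length xs = k \<and> sum_list xs = N} \<subseteq> {xs. set xs \<subseteq> {..N} \<and> length xs = k}"
    by (auto intro: member_le_sum_list)
qed (simp add: finite_lists_length_eq)

lemma finite_pos_lecture_hall_weight: "finite {xs \<in> pos_lecture_hall n k. sum_list xs = N}"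
  by (rule finite_subset[OF _ finite_lists_length_sum[of k N]]) (auto simp: pos_lecture_hall_def)

lemma finite_strict_lists_weight: "finite {xs \<in> strict_lists n k. sum_list xs = N}"
  by (rule finite_subset[OF _ finite_lists_length_sum[of k N]]) (auto simp: strict_lists_def)

text \<open>The head is the largest entry, and it either equals \<open>Suc n\<close> or is smaller.
  This mirrors the recursion of \<open>qbinom\<close>.\<close>

lemma strict_lists_Suc:
  "strict_lists (Suc n) (Suc k) = strict_lists n (Suc k) \<union> (#) (Suc n) ` strict_lists n k"
proof (intro equalityI subsetI)
  fix xs assume xs: "xs \<in> strict_lists (Suc n) (Suc k)"
  then obtain y ys where y: "xs = y # ys" by (cases xs) (auto simp: strict_lists_def)
  have ys: "z < y" "z \<ge> 1" if "z \<in> set ys" for z using xs y that by (auto simp: strict_lists_def)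
  have "y \<le> Suc n" "1 \<le> y" using xs y by (auto simp: strict_lists_def)
  show "xs \<in> strict_lists n (Suc k) \<union> (#) (Suc n) ` strict_lists n k"
  proof (cases "y = Suc n")
    case True
    hence "ys \<in> strict_lists n k"
      using xs y ys by (auto simp: strict_lists_def subset_iff less_Suc_eq_le)
    thus ?thesis using y True by blast
  next
    case False
    hence "xs \<in> strict_lists n (Suc k)"
      using xs y \<open>y \<le> Suc n\<close> \<open>1 \<le> y\<close> ys(2) order.strict_trans2[OF ys(1) \<open>y \<le> Suc n\<close>]
      by (auto simp: strict_lists_def subset_iff less_Suc_eq_le)
    thus ?thesis by blast
  qed
qed (auto simp: strict_lists_def subset_iff less_Suc_eq_le)

text \<open>The classical generating function of partitions into \<open>k\<close> distinct parts of
  size at most \<open>n\<close>. A new largest part \<open>Suc n\<close> accounts both for the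
  growth of the triangular exponent and for the factor \<open>q ^ (n - k)\<close> in the recursion
  of \<open>qbinom\<close>.\<close>

lemma weighted_gf_strict_lists:
  "weighted_gf (strict_lists n k) sum_list (\<lambda>_. 1) =
     fps_X ^ (k + 1 choose 2) * qbinom fps_X n k"
proof (induction "fps_X :: 'a::comm_ring_1 fps" n k rule: qbinom.induct)
  case (1 n)
  have "strict_lists n 0 = {[]}" by (auto simp: strict_lists_def)
  moreover have "{x. x = [] \<and> sum_list x = N} = (if N = 0 then {[]} else {})" for N :: nat
    by auto
  ultimately show ?case
    by (intro fps_ext) (simp add: weighted_gf_def numeral_2_eq_2)
next
  case (2 k)
  have "strict_lists 0 (Suc k) = {}" by (auto simp: strict_lists_def)
  thus ?case by (intro fps_ext) (simp add: weighted_gf_def)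
next
  case (3 n k)
  let ?W = "\<lambda>S. weighted_gf S sum_list (\<lambda>_. 1 :: 'a)"
  \<comment> \<open>Indexing the two pieces by \<open>bool\<close> makes the rule for indexed unions
    applicable.\<close>
  have "?W (strict_lists (Suc n) (Suc k)) =
        ?W (\<Union>b. if b then strict_lists n (Suc k) else (#) (Suc n) ` strict_lists n k)"
    by (simp add: strict_lists_Suc UNIV_bool Un_commute)
  also have "\<dots> = (\<Sum>b\<in>UNIV. ?W (if b then strict_lists n (Suc k) else (#) (Suc n) ` strict_lists n k))"
  proof (rule weighted_gf_UN)
    show "finite {x \<in> if b then strict_lists n (Suc k) else (#) (Suc n) ` strict_lists n k.
             sum_list x = N}" for b N
      by (rule finite_subset[OF _ finite_strict_lists_weight[of "Suc n" "Suc k" N]])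
         (auto simp: strict_lists_Suc)
    show "(if b then strict_lists n (Suc k) else (#) (Suc n) ` strict_lists n k) \<inter>
          (if b' then strict_lists n (Suc k) else (#) (Suc n) ` strict_lists n k) = {}"
      if "b \<noteq> b'" for b b'
      using that by (auto simp: strict_lists_def)
  qed simp
  also have "\<dots> = ?W (strict_lists n (Suc k)) + ?W ((#) (Suc n) ` strict_lists n k)"
    by (simp add: UNIV_bool)
  also have "?W ((#) (Suc n) ` strict_lists n k) =
      weighted_gf (strict_lists n k) (\<lambda>xs. Suc n + sum_list xs) (\<lambda>_. 1 * 1)"
    by (rule weighted_gf_bij_betw[of "(#) (Suc n)"]) (auto simp: bij_betw_def)
  also have "\<dots> = fps_X ^ Suc n * ?W (strict_lists n k)"
    unfolding weighted_gf_shift by simp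
  also have "\<dots> = fps_X ^ (Suc k + 1 choose 2) * (fps_X ^ (n - k) * qbinom fps_X n k)"
  \<comment> \<open>For \<open>n < k\<close> the exponent \<open>n - k\<close> is truncated, but
    then both sides are 0.\<close>
  proof (cases "k \<le> n")
    case True
    hence "Suc n + (k + 1 choose 2) = (Suc k + 1 choose 2) + (n - k)" by (simp add: numeral_2_eq_2)
    hence "(fps_X :: 'a fps) ^ Suc n * fps_X ^ (k + 1 choose 2) =
        fps_X ^ (Suc k + 1 choose 2) * fps_X ^ (n - k)" by (metis power_add)
    thus ?thesis using 3 by (metis mult.assoc)
  qed (use 3 in \<open>simp add: qbinom_eq_0\<close>)
  finally show ?case using 3 by (simp add: algebra_simps)
qed

subsection \<open>Removing a staircase\<close>

fun add_stair :: "nat \<Rightarrow> nat list \<Rightarrow> nat list" where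
  "add_stair n [] = []"
| "add_stair n (x # xs) = (x + n) # add_stair (n - 1) xs"

lemma length_add_stair [simp]: "length (add_stair n xs) = length xs"
  by (induction n xs rule: add_stair.induct) auto

lemma sum_list_add_stair: "sum_list (add_stair n xs) = (\<Sum>j<length xs. n - j) + sum_list xs"
  by (induction n xs rule: add_stair.induct) (simp_all add: sum.lessThan_Suc_shift del: sum.lessThan_Suc)

lemma strict_lists_Cons:
  "x # xs \<in> strict_lists n (Suc k) \<Longrightarrow> xs \<in> strict_lists (n - 1) k \<and> x \<in> {1..n}"
  by (fastforce simp: strict_lists_def)

text \<open>From \<open>y \<le> x - 1\<close> and \<open>x \<le> n\<close> one gets
  \<open>y * n \<le> x * n - n \<le> x * n - x\<close>.\<close>

lemma lecture_hall_strict: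
  "xs \<in> strict_lists n k \<Longrightarrow> lecture_hall n xs"
proof (induction n xs arbitrary: k rule: lecture_hall.induct)
  case (1 n x y ys)
  then obtain k' where k': "k = Suc k'" by (cases k) (auto simp: strict_lists_def)
  have xy: "y < x" "x \<le> n" using 1 by (auto simp: strict_lists_def)
  have "y * n \<le> (x - 1) * n" using xy by (intro mult_right_mono) auto
  also have "\<dots> \<le> x * (n - 1)" using xy by (simp add: diff_mult_distrib diff_mult_distrib2)
  finally show ?case using 1 strict_lists_Cons[of x "y # ys" n k'] k' by auto
qed auto

text \<open>Bounding the head suffices: for positive \<open>x\<close> the ratio condition gives
  \<open>y * n \<le> x * (n - 1) < x * n\<close>, so \<open>y < x \<le> n\<close> and the bound
  \<open>y \<le> n - 1\<close> passes to the tail.\<close>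

lemma lecture_hall_le_imp_strict:
  "\<lbrakk>lecture_hall n xs; 0 \<notin> set xs; xs \<noteq> [] \<Longrightarrow> hd xs \<le> n; length xs \<le> n\<rbrakk> \<Longrightarrow>
     xs \<in> strict_lists n (length xs)"
proof (induction n xs rule: lecture_hall.induct)
  case (1 n x y ys)
  have x: "0 < x" "x \<le> n" and n: "0 < n" and le: "y * n \<le> x * (n - 1)" using 1 by auto
  have "x * (n - 1) < x * n" using x n by simp
  with le have "y * n < x * n" by (rule le_less_trans)
  hence yx: "y < x" by simp
  have "y # ys \<in> strict_lists (n - 1) (length (y # ys))" using 1 yx x by auto
  thus ?case using x yx by (fastforce simp: strict_lists_def)
qed (auto simp: strict_lists_def Suc_le_eq)

text \<open>Adding the staircase raises every ratio by 1. At the junction the last raised ratio is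
  at least 1, while the first ratio of \<open>ys\<close> is at most 1.\<close>

lemma lecture_hall_add_stair_append:
  "\<lbrakk>lecture_hall n xs; ys \<in> strict_lists (n - length xs) k\<rbrakk> \<Longrightarrow>
     lecture_hall n (add_stair n xs @ ys)"
proof (induction n xs rule: lecture_hall.induct)
  case (1 n x y zs)
  have "y * n + (n - 1) * n \<le> x * (n - 1) + n * (n - 1)"
    using 1 by (simp add: mult.commute)
  hence "(y + (n - 1)) * n \<le> (x + n) * (n - 1)"
    by (simp only: add_mult_distrib)
  thus ?case using 1 by simp
next
  case ("2_1" n)
  thus ?case using lecture_hall_strict by simp
next
  case ("2_2" n x)
  show ?case
  proof (cases ys)
    case (Cons y ys')
    have "y \<le> n - 1" using "2_2" Cons by (auto simp: strict_lists_def)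
    hence "y * n \<le> (n - 1) * n" by simp
    also have "\<dots> \<le> (x + n) * (n - 1)"
      using mult_le_mono[of n "x + n" "n - 1" "n - 1"] by (simp add: mult.commute)
    finally show ?thesis using "2_2" Cons lecture_hall_strict by auto
  qed auto
qed

text \<open>Ratios do not increase, so the entries with ratio above 1 form a prefix. The staircase
  is subtracted there and leaves positive entries; from the first entry that is at most its
  denominator onwards, \<open>lecture_hall_le_imp_strict\<close> applies.\<close>

lemma lecture_hall_split:
  "\<lbrakk>lecture_hall n xs; 0 \<notin> set xs; length xs \<le> n\<rbrakk> \<Longrightarrow>
     \<exists>ys zs. xs = add_stair n ys @ zs \<and> ys \<in> pos_lecture_hall n (length ys) \<and>
       zs \<in> strict_lists (n - length ys) (length zs)"
proof (induction xs arbitrary: n)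
  case Nil
  thus ?case by (intro exI[of _ "[]"]) (auto simp: pos_lecture_hall_def strict_lists_def)
next
  case (Cons x xs)
  show ?case
  proof (cases "x \<le> n")
    case True
    thus ?thesis using lecture_hall_le_imp_strict[of n "x # xs"] Cons.prems
      by (intro exI[of _ "[]"] exI[of _ "x # xs"]) (auto simp: pos_lecture_hall_def)
  next
    case False
    have lh: "lecture_hall (n - 1) xs" using Cons.prems by (cases xs) auto
    have len: "length xs \<le> n - 1" using Cons.prems by auto
    obtain ys zs where xs: "xs = add_stair (n - 1) ys @ zs"
      and ys: "ys \<in> pos_lecture_hall (n - 1) (length ys)"
      and zs: "zs \<in> strict_lists (n - 1 - length ys) (length zs)"
      using Cons.IH[OF lh _ len] Cons.prems by auto
    have "lecture_hall n ((x - n) # ys)"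
    proof (cases ys)
      case (Cons y ys')
      hence "(y + (n - 1)) * n \<le> x * (n - 1)" using Cons.prems xs by auto
      also have "x = (x - n) + n" using False by simp
      finally have "y * n + (n - 1) * n \<le> (x - n) * (n - 1) + n * (n - 1)"
        by (simp only: add_mult_distrib)
      hence "y * n \<le> (x - n) * (n - 1)" by (simp add: mult.commute)
      thus ?thesis using ys Cons by (auto simp: pos_lecture_hall_def)
    qed auto
    thus ?thesis using xs ys zs False Cons.prems
      by (intro exI[of _ "(x - n) # ys"] exI[of _ zs]) (auto simp: pos_lecture_hall_def)
  qed
qed

text \<open>The cut can be recovered: entries of the raised prefix exceed their denominators because
  \<open>xs\<close> is positive, and entries of the strict suffix do not.\<close>

lemma add_stair_append_inject:
  "\<lbrakk>add_stair n xs @ ys = add_stair n xs' @ ys'; 0 \<notin> set xs; 0 \<notin> set xs';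
    ys \<in> strict_lists (n - length xs) k; ys' \<in> strict_lists (n - length xs') k'\<rbrakk> \<Longrightarrow>
   xs = xs' \<and> ys = ys'"
proof (induction n xs arbitrary: xs' rule: add_stair.induct)
  case (1 n)
  thus ?case by (cases xs') (auto simp: strict_lists_def)
next
  case (2 n x xs)
  show ?case
  proof (cases xs')
    case Nil
    thus ?thesis using 2 by (auto simp: strict_lists_def)
  next
    case (Cons x' xs'')
    thus ?thesis using 2 by auto
  qed
qed

lemma bij_betw_pos_lecture_hall:
  assumes "k \<le> n"
  shows "bij_betw (\<lambda>(xs, ys). add_stair n xs @ ys)
           (\<Union>m\<le>k. pos_lecture_hall n m \<times> strict_lists (n - m) (k - m)) (pos_lecture_hall n k)"
  unfolding bij_betw_def
proof (intro conjI equalityI subsetI)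
  show "inj_on (\<lambda>(xs, ys). add_stair n xs @ ys)
           (\<Union>m\<le>k. pos_lecture_hall n m \<times> strict_lists (n - m) (k - m))"
    by (rule inj_onI) (auto simp: pos_lecture_hall_def dest: add_stair_append_inject)
next
  fix zs
  assume "zs \<in> (\<lambda>(xs, ys). add_stair n xs @ ys) `
      (\<Union>m\<le>k. pos_lecture_hall n m \<times> strict_lists (n - m) (k - m))"
  then obtain m xs ys where "m \<le> k" and xs: "xs \<in> pos_lecture_hall n m"
    and ys: "ys \<in> strict_lists (n - m) (k - m)" and zs: "zs = add_stair n xs @ ys" by auto
  have "0 \<notin> set (add_stair n xs)" if "0 \<notin> set xs" for n xs
    using that by (induction n xs rule: add_stair.induct) auto
  thus "zs \<in> pos_lecture_hall n k"
    using \<open>m \<le> k\<close> xs ys zs lecture_hall_add_stair_append[of n xs ys "k - m"]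
    by (auto simp: pos_lecture_hall_def strict_lists_def)
next
  fix zs assume "zs \<in> pos_lecture_hall n k"
  hence *: "lecture_hall n zs" "0 \<notin> set zs" "length zs = k" by (auto simp: pos_lecture_hall_def)
  then obtain xs ys where xy: "zs = add_stair n xs @ ys" "xs \<in> pos_lecture_hall n (length xs)"
       "ys \<in> strict_lists (n - length xs) (length ys)"
    using lecture_hall_split[of n zs] assms by auto
  moreover have "length xs \<le> k" "length ys = k - length xs" using * xy by auto
  ultimately show "zs \<in> (\<lambda>(xs, ys). add_stair n xs @ ys) `
      (\<Union>m\<le>k. pos_lecture_hall n m \<times> strict_lists (n - m) (k - m))"
    by (intro image_eqI[of _ _ "(xs, ys)"]) auto
qed

section \<open>Trailing zeros\<close>

lemma lecture_hall_zeros: "lecture_hall n (replicate j 0)"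
proof (induction j arbitrary: n)
  case (Suc j)
  thus ?case by (cases j) auto
qed simp

lemma lecture_hall_append_zeros:
  "lecture_hall n xs \<Longrightarrow> lecture_hall n (xs @ replicate j 0)"
proof (induction n xs rule: lecture_hall.induct)
  case ("2_1" n)
  show ?case by (simp add: lecture_hall_zeros)
next
  case ("2_2" n x)
  show ?case using lecture_hall_zeros[of "n - 1" j] by (cases j) auto
qed auto

text \<open>A zero entry forces the next one to be zero, since the denominators are positive when
  \<open>length xs \<le> n\<close>.\<close>

lemma lecture_hall_split_zeros:
  "\<lbrakk>lecture_hall n xs; length xs \<le> n\<rbrakk> \<Longrightarrow>
     \<exists>ys j. xs = ys @ replicate j 0 \<and> lecture_hall n ys \<and> 0 \<notin> set ys"
proof (induction n xs rule: lecture_hall.induct)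
  case (1 n x y zs)
  have "lecture_hall (n - 1) (y # zs)" "length (y # zs) \<le> n - 1" using 1 by auto
  then obtain ys j where *: "y # zs = ys @ replicate j 0" "lecture_hall (n - 1) ys" "0 \<notin> set ys"
    using "1.IH" by blast
  have le: "y * n \<le> x * (n - 1)" and "n > 0" using 1 by auto
  show ?case
  proof (cases ys)
    case Nil
    show ?thesis
    proof (cases "x = 0")
      case True
      thus ?thesis using * Nil by (intro exI[of _ "[]"] exI[of _ "Suc j"]) auto
    next
      case False
      thus ?thesis using * Nil by (intro exI[of _ "[x]"] exI[of _ j]) auto
    qed
  next
    case (Cons y' ys')
    hence "y > 0" using * by auto
    hence "x > 0" using le \<open>n > 0\<close> by (cases "x = 0") auto
    thus ?thesis using * Cons le by (intro exI[of _ "x # ys"] exI[of _ j]) auto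
  qed
next
  case ("2_1" n)
  show ?case by (intro exI[of _ "[]"] exI[of _ 0]) auto
next
  case ("2_2" n x)
  show ?case
  proof (cases "x = 0")
    case True
    thus ?thesis by (intro exI[of _ "[]"] exI[of _ 1]) auto
  next
    case False
    thus ?thesis by (intro exI[of _ "[x]"] exI[of _ 0]) auto
  qed
qed

lemma truncated_lecture_hall_eq_UN:
  assumes "k \<le> n"
  shows "truncated_lecture_hall n k =
           (\<Union>m\<le>k. (\<lambda>xs. xs @ replicate (k - m) 0) ` pos_lecture_hall n m)"
proof (intro equalityI subsetI)
  fix xs assume "xs \<in> truncated_lecture_hall n k"
  hence *: "length xs = k" "lecture_hall n xs" by (simp_all add: truncated_lecture_hall_iff assms)
  then obtain ys j where "xs = ys @ replicate j 0" "lecture_hall n ys" "0 \<notin> set ys"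
    using lecture_hall_split_zeros[of n xs] assms by auto
  moreover have "j = k - length ys" "length ys \<le> k" using * calculation by auto
  ultimately show "xs \<in> (\<Union>m\<le>k. (\<lambda>xs. xs @ replicate (k - m) 0) ` pos_lecture_hall n m)"
    by (auto simp: pos_lecture_hall_def)
qed (auto simp: truncated_lecture_hall_iff assms pos_lecture_hall_def
       intro: lecture_hall_append_zeros)

section \<open>Ceilings and parity weights\<close>

lemma ceil_seq_Nil [simp]: "ceil_seq n [] = []"
  by (simp add: ceil_seq_def)

lemma ceil_seq_Cons [simp]:
  "ceil_seq n (x # xs) = nat \<lceil>real x / real n\<rceil> # ceil_seq (n - 1) xs"
  by (simp add: ceil_seq_def upt_conv_Cons map_Suc_upt[symmetric] o_def del: upt_Suc)

lemma ceil_seq_append: "ceil_seq n (xs @ ys) = ceil_seq n xs @ ceil_seq (n - length xs) ys"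
  by (induction xs arbitrary: n) auto

lemma length_ceil_seq [simp]: "length (ceil_seq n xs) = length xs"
  by (simp add: ceil_seq_def)

text \<open>The length bound keeps the denominators positive; at denominator 0 the quotient is 0 by
  convention and the ceiling would not rise.\<close>

lemma ceil_seq_add_stair: "length xs \<le> n \<Longrightarrow> ceil_seq n (add_stair n xs) = map Suc (ceil_seq n xs)"
proof (induction n xs rule: add_stair.induct)
  case (2 n x xs)
  have "real (x + n) / real n = real x / real n + 1" using 2 by (simp add: field_simps)
  hence "\<lceil>real (x + n) / real n\<rceil> = \<lceil>real x / real n\<rceil> + 1" by simp
  moreover have "\<lceil>real x / real n\<rceil> \<ge> 0" by (metis ceiling_mono ceiling_zero divide_nonneg_nonneg of_nat_0_le_iff)
  ultimately have "nat \<lceil>real (x + n) / real n\<rceil> = Suc (nat \<lceil>real x / real n\<rceil>)"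
    by (metis Suc_nat_eq_nat_zadd1 add.commute)
  thus ?case using 2 by simp
qed simp

lemma ceil_seq_strict: "xs \<in> strict_lists n k \<Longrightarrow> ceil_seq n xs = replicate k 1"
proof (induction xs arbitrary: n k)
  case (Cons x xs)
  then obtain k' where k': "k = Suc k'" by (cases k) (auto simp: strict_lists_def)
  have *: "xs \<in> strict_lists (n - 1) k'" "x \<in> {1..n}" using Cons.prems strict_lists_Cons k' by auto
  hence "\<lceil>real x / real n\<rceil> = 1" by (simp add: ceiling_eq_iff)
  thus ?case using * Cons.IH k' by simp
qed (auto simp: strict_lists_def)

lemma ceil_seq_zeros: "ceil_seq n (replicate k 0) = replicate k 0"
  by (induction k arbitrary: n) auto

text \<open>
  With a separate weight \<open>w\<close> for even entries, incrementing all entries swaps \<open>v\<close> and \<open>w\<close> instead of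
  inverting \<open>v\<close>, so no division is needed.
\<close>

definition parity_weight :: "'a \<Rightarrow> 'a \<Rightarrow> 'a \<Rightarrow> nat list \<Rightarrow> 'a::comm_ring_1" where
  "parity_weight u v w cs = prod_list (map (\<lambda>c. u ^ c * (if odd c then v else w)) cs)"

lemma parity_weight_append:
  "parity_weight u v w (xs @ ys) = parity_weight u v w xs * parity_weight u v w ys"
  by (simp add: parity_weight_def)

lemma parity_weight_map_Suc:
  "parity_weight u v w (map Suc cs) = u ^ length cs * parity_weight u w v cs"
  by (induction cs) (auto simp: parity_weight_def mult_ac)

lemma parity_weight_replicate:
  "parity_weight u v w (replicate k c) = (u ^ c * (if odd c then v else w)) ^ k"
  by (simp add: parity_weight_def)

lemma parity_weight_1: "parity_weight u v 1 cs = u ^ sum_list cs * v ^ num_odd cs"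
  by (induction cs) (auto simp: parity_weight_def num_odd_def power_add mult_ac)

section \<open>Generating function of positive sequences and its recurrence\<close>

definition pos_gf :: "nat \<Rightarrow> nat \<Rightarrow> 'a \<Rightarrow> 'a \<Rightarrow> 'a \<Rightarrow> 'a::comm_ring_1 fps" where
  "pos_gf n k u v w =
     weighted_gf (pos_lecture_hall n k) sum_list (\<lambda>xs. parity_weight u v w (ceil_seq n xs))"

lemma truncated_lecture_hall_gf_eq:
  assumes "k \<le> n"
  shows "truncated_lecture_hall_gf n k u v = (\<Sum>m\<le>k. pos_gf n m u v 1)"
proof -
  let ?f = "\<lambda>xs. parity_weight u v 1 (ceil_seq n xs)"
  let ?S = "\<lambda>m. (\<lambda>xs. xs @ replicate (k - m) 0) ` pos_lecture_hall n m"
  have "truncated_lecture_hall_gf n k u v = weighted_gf (truncated_lecture_hall n k) sum_list ?f"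
    by (simp add: truncated_lecture_hall_gf_def weighted_gf_def parity_weight_1)
  also have "\<dots> = weighted_gf (\<Union>m\<in>{..k}. ?S m) sum_list ?f"
    unfolding truncated_lecture_hall_eq_UN[OF assms] ..
  also have "\<dots> = (\<Sum>m\<le>k. weighted_gf (?S m) sum_list ?f)"
  proof (rule weighted_gf_UN)
    show "finite {xs \<in> ?S m. sum_list xs = N}" if "m \<in> {..k}" for m N
      by (rule finite_subset[OF _ finite_lists_length_sum[of k N]])
         (use that in \<open>auto simp: pos_lecture_hall_def\<close>)
  next
    fix i j assume ij: "i \<in> {..k}" "j \<in> {..k}" "i \<noteq> j"
    \<comment> \<open>The number of nonzero entries recovers \<open>m\<close>, which makes the
      pieces disjoint.\<close>
    have positive: "length (filter (\<lambda>x. x \<noteq> 0) xs) = m" if "xs \<in> ?S m" for xs m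
    proof -
      obtain ys where ys: "xs = ys @ replicate (k - m) 0" "ys \<in> pos_lecture_hall n m"
        using \<open>xs \<in> ?S m\<close> by blast
      hence "0 \<notin> set ys" "length ys = m" by (simp_all add: pos_lecture_hall_def)
      moreover from this have "\<forall>x\<in>set ys. x \<noteq> 0" by metis
      ultimately show ?thesis unfolding ys(1) filter_append by simp
    qed
    show "?S i \<inter> ?S j = {}"
    proof (rule equals0I)
      fix xs assume "xs \<in> ?S i \<inter> ?S j"
      hence "xs \<in> ?S i" "xs \<in> ?S j" by blast+
      from this[THEN positive] ij show False by simp
    qed
  qed simp
  also have "\<dots> = (\<Sum>m\<le>k. pos_gf n m u v 1)"
    unfolding pos_gf_def
    by (intro sum.cong refl weighted_gf_bij_betw[of "\<lambda>xs. xs @ replicate (k - m) 0" for m])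
       (auto simp: bij_betw_def inj_on_def ceil_seq_append ceil_seq_zeros
          parity_weight_append parity_weight_replicate sum_list_replicate)
  finally show ?thesis .
qed

lemma pos_gf_0: "pos_gf n 0 u v w = 1"
proof -
  have "{xs. xs \<in> pos_lecture_hall n 0 \<and> sum_list xs = N} = (if N = 0 then {[]} else {})" for N
    by (auto simp: pos_lecture_hall_def)
  thus ?thesis
    by (intro fps_ext) (simp add: pos_gf_def weighted_gf_def parity_weight_def)
qed

text \<open>Read off from \<open>bij_betw_pos_lecture_hall\<close>: the staircase contributes
  \<open>u ^ m\<close> and its sum to the exponent and swaps \<open>v\<close> and \<open>w\<close>,
  while each of the \<open>k - m\<close> suffix entries has ceiling 1 and weight
  \<open>u * v\<close>. The summand \<open>m = k\<close> contains the unknown series itself, with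
  \<open>v\<close> and \<open>w\<close> swapped.\<close>

lemma pos_gf_rec:
  assumes "k \<le> n"
  shows "pos_gf n k u v w =
    (\<Sum>m\<le>k. fps_const (u ^ m) * fps_X ^ (\<Sum>j<m. n - j) * pos_gf n m u w v *
       (fps_const ((u * v) ^ (k - m)) * (fps_X ^ (k - m + 1 choose 2) * qbinom fps_X (n - m) (k - m))))"
proof -
  let ?h = "\<lambda>(xs, ys). add_stair n xs @ ys"
  let ?S = "\<lambda>m. pos_lecture_hall n m \<times> strict_lists (n - m) (k - m)"
  let ?w = "\<lambda>v w xs. parity_weight u v w (ceil_seq n xs)"
  have "pos_gf n k u v w = weighted_gf (\<Union>m\<le>k. ?S m) (sum_list \<circ> ?h) (?w v w \<circ> ?h)"
    unfolding pos_gf_def by (rule weighted_gf_bij_betw[OF bij_betw_pos_lecture_hall[OF assms]]) auto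
  also have "\<dots> = (\<Sum>m\<le>k. weighted_gf (?S m) (sum_list \<circ> ?h) (?w v w \<circ> ?h))"
  proof (rule weighted_gf_UN)
    show "finite {p \<in> ?S m. (sum_list \<circ> ?h) p = N}" for m N
    proof (rule finite_subset)
      show "{p \<in> ?S m. (sum_list \<circ> ?h) p = N} \<subseteq>
              {xs. set xs \<subseteq> {..N} \<and> length xs = m} \<times> {xs. set xs \<subseteq> {..N} \<and> length xs = k - m}"
        by (auto simp: pos_lecture_hall_def strict_lists_def sum_list_add_stair
             dest!: member_le_sum_list)
    qed (auto simp: finite_lists_length_eq)
    show "?S i \<inter> ?S j = {}" if "i \<noteq> j" for i j
      using that by (auto simp: pos_lecture_hall_def)
  qed simp
  \<comment> \<open>The neutral \<open>0 +\<close> and \<open>* 1\<close> give the suffix factor the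
    shape required by \<open>weighted_gf_shift\<close>.\<close>
  also have "\<dots> = (\<Sum>m\<le>k. weighted_gf (?S m)
       (\<lambda>(xs, ys). ((\<Sum>j<m. n - j) + sum_list xs) + (0 + sum_list ys))
       (\<lambda>(xs, ys). (u ^ m * ?w w v xs) * ((u * v) ^ (k - m) * 1)))"
  proof (intro sum.cong refl weighted_gf_cong)
    fix m p assume m: "m \<in> {..k}" and p: "p \<in> ?S m"
    obtain xs ys where [simp]: "p = (xs, ys)" by (cases p)
    have [simp]: "length xs = m" and ys: "ys \<in> strict_lists (n - m) (k - m)"
      using p by (auto simp: pos_lecture_hall_def)
    show "(sum_list \<circ> ?h) p =
        (case p of (xs, ys) \<Rightarrow> ((\<Sum>j<m. n - j) + sum_list xs) + (0 + sum_list ys))"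
      by (simp add: sum_list_add_stair)
    show "(?w v w \<circ> ?h) p =
        (case p of (xs, ys) \<Rightarrow> (u ^ m * ?w w v xs) * ((u * v) ^ (k - m) * 1))"
      using m assms ys
      by (simp add: ceil_seq_append ceil_seq_strict ceil_seq_add_stair parity_weight_append
            parity_weight_map_Suc parity_weight_replicate)
  qed
  also have "\<dots> = (\<Sum>m\<le>k. weighted_gf (pos_lecture_hall n m)
       (\<lambda>xs. (\<Sum>j<m. n - j) + sum_list xs) (\<lambda>xs. u ^ m * ?w w v xs) *
       weighted_gf (strict_lists (n - m) (k - m)) (\<lambda>ys. 0 + sum_list ys) (\<lambda>ys. (u * v) ^ (k - m) * 1))"
  proof (intro sum.cong refl weighted_gf_Times)
    show "finite {xs \<in> pos_lecture_hall n m. (\<Sum>j<m. n - j) + sum_list xs = N}" for m N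
      by (rule finite_subset[OF _ finite_pos_lecture_hall_weight[of n m "N - (\<Sum>j<m. n - j)"]]) auto
    show "finite {ys \<in> strict_lists (n - m) (k - m). 0 + sum_list ys = N}" for m N
      using finite_strict_lists_weight[of "n - m" "k - m" N] by simp
  qed
  also have "\<dots> = (\<Sum>m\<le>k. fps_const (u ^ m) * fps_X ^ (\<Sum>j<m. n - j) * pos_gf n m u w v *
       (fps_const ((u * v) ^ (k - m)) * (fps_X ^ (k - m + 1 choose 2) * qbinom fps_X (n - m) (k - m))))"
    unfolding weighted_gf_shift weighted_gf_strict_lists pos_gf_def by (simp add: mult.assoc)
  finally show ?thesis .
qed

subsection \<open>The product formula\<close>

text \<open>Homogeneous in \<open>v\<close> and \<open>w\<close>, so the swap in the recurrence
  needs no division by \<open>v\<close>.\<close>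

definition pos_num :: "nat \<Rightarrow> nat \<Rightarrow> 'a \<Rightarrow> 'a \<Rightarrow> 'a \<Rightarrow> 'a::field fps" where
  "pos_num n k u v w = fps_const (u ^ k) * fps_X ^ (k + 1 choose 2) * qbinom fps_X n k *
     (\<Prod>j<k. fps_const v + fps_const u * fps_const w * fps_X ^ (n - j))"

definition pos_den :: "nat \<Rightarrow> nat \<Rightarrow> 'a \<Rightarrow> 'a::field fps" where
  "pos_den n k u = (\<Prod>j<k. 1 - (fps_const u)\<^sup>2 * fps_X ^ (n + n - j))"

lemma pos_den_nth_0: "k \<le> n \<Longrightarrow> fps_nth (pos_den n k u) 0 = 1"
  by (induction k) (simp_all add: pos_den_def)

lemma pos_den_neq_0: "k \<le> n \<Longrightarrow> pos_den n k u \<noteq> 0"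
  using pos_den_nth_0[of k n u] by auto

text \<open>This and \<open>choose_2_diff\<close> match the exponents of the recurrence with those
  of \<open>q_vandermonde\<close>; both are stated additively to avoid truncated subtraction of
  binomials.\<close>

lemma sum_stair: "m \<le> n \<Longrightarrow> (\<Sum>j<m. n - j) + (m choose 2) = n * m"
proof (induction m)
  case (Suc m)
  have "(Suc m choose 2) = m + (m choose 2)" by (simp add: numeral_2_eq_2)
  thus ?case using Suc by (simp add: mult.commute)
qed (simp add: numeral_2_eq_2)

lemma choose_2_diff: "m \<le> k \<Longrightarrow> (k - m + 1 choose 2) + k * m = (k + 1 choose 2) + (m choose 2)"
proof (induction m)
  case (Suc m)
  then obtain d where "k = Suc (m + d)" using less_imp_Suc_add[of m k] by auto
  thus ?case using Suc by (simp add: numeral_2_eq_2)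
qed (simp add: numeral_2_eq_2)

text \<open>After multiplication by \<open>pos_den n k u\<close>, \<open>qbinom_mult\<close> pulls
  out a factor independent of \<open>m\<close>, and the remaining sum is
  \<open>q_vandermonde\<close> with both of its parameters \<open>a\<close> and \<open>b\<close>
  equal to \<open>n\<close>.\<close>

lemma pos_gf_rec_closed:
  assumes "k \<le> n"
  shows "pos_num n k u v w / pos_den n k u =
    (\<Sum>m\<le>k. fps_const (u ^ m) * fps_X ^ (\<Sum>j<m. n - j) * (pos_num n m u w v / pos_den n m u) *
       (fps_const ((u * v) ^ (k - m)) * (fps_X ^ (k - m + 1 choose 2) * qbinom fps_X (n - m) (k - m))))"
    (is "_ = (\<Sum>m\<le>k. ?t m)")
proof -
  let ?c = "fps_const (u ^ k) * fps_X ^ (k + 1 choose 2) * qbinom fps_X n k :: 'a fps"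
  let ?u = "fps_const u" and ?v = "fps_const v" and ?w = "fps_const w"
  define s where "s m = ?v ^ (k - m) * ?u ^ m * fps_X ^ (m * (n - k) + (m + 1 choose 2)) *
             (\<Prod>j<m. ?w + ?u * ?v * fps_X ^ (n - j)) * (\<Prod>j\<in>{m..<k}. 1 - ?u\<^sup>2 * fps_X ^ (n + n - j))"
    for m
  have t: "?t m * pos_den n k u = ?c * (qbinom fps_X k m * s m)" if m: "m \<le> k" for m
  proof -
    define D where "D = (\<Prod>j\<in>{m..<k}. 1 - ?u\<^sup>2 * fps_X ^ (n + n - j))"
    define P where "P = (\<Prod>j<m. ?w + ?u * ?v * fps_X ^ (n - j))"
    \<comment> \<open>The factors with \<open>j < m\<close> cancel the denominator of the summand;
      the rest, \<open>D\<close>, becomes the second product in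
      \<open>q_vandermonde\<close>.\<close>
    have den: "pos_den n k u = pos_den n m u * D"
      unfolding pos_den_def D_def using m
      by (simp only: lessThan_atLeast0 prod.atLeastLessThan_concat le0)
    define Q where "Q = pos_num n m u w v / pos_den n m u"
    have Q: "Q * pos_den n m u = pos_num n m u w v"
      unfolding Q_def using pos_den_nth_0[of m n u] m assms
      by (simp add: fps_divide_unit mult.assoc inverse_mult_eq_1)
    define R where "R = fps_const ((u * v) ^ (k - m)) *
       (fps_X ^ (k - m + 1 choose 2) * qbinom fps_X (n - m) (k - m))"
    have "?t m * pos_den n k u =
        fps_const (u ^ m) * fps_X ^ (\<Sum>j<m. n - j) * (Q * pos_den n m u) * D * R"
      unfolding den Q_def[symmetric] R_def[symmetric] by (simp only: mult_ac)
    also have "\<dots> = fps_const (u ^ m * u ^ m * (u * v) ^ (k - m)) *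
        fps_X ^ ((\<Sum>j<m. n - j) + (m + 1 choose 2) + (k - m + 1 choose 2)) *
        (qbinom fps_X n m * qbinom fps_X (n - m) (k - m)) * P * D"
      unfolding Q pos_num_def P_def[symmetric] R_def
      by (simp only: power_add fps_const_mult[symmetric] mult_ac)
    also have "u ^ m * u ^ m * (u * v) ^ (k - m) = u ^ k * (v ^ (k - m) * u ^ m)"
    proof -
      have "u ^ k = u ^ m * u ^ (k - m)" using m by (metis le_add_diff_inverse power_add)
      thus ?thesis by (simp only: power_mult_distrib mult_ac)
    qed
    also have "(\<Sum>j<m. n - j) + (m + 1 choose 2) + (k - m + 1 choose 2) =
        (k + 1 choose 2) + (m * (n - k) + (m + 1 choose 2))"
    proof -
      have "m * (n - k) + k * m = n * m"
        using assms by (simp only: mult.commute[of _ m] add_mult_distrib2[symmetric] le_add_diff_inverse2)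
      thus ?thesis using sum_stair[of m n] choose_2_diff[of m k] m assms by linarith
    qed
    also note qbinom_mult[OF m assms]
    finally show ?thesis
      unfolding s_def P_def[symmetric] D_def[symmetric]
      by (simp only: power_add fps_const_mult[symmetric] fps_const_power[symmetric] mult_ac)
  qed
  have "(\<Sum>m\<le>k. ?t m) * pos_den n k u = ?c * (\<Sum>m\<le>k. qbinom fps_X k m * s m)"
    unfolding sum_distrib_right sum_distrib_left by (intro sum.cong refl t) auto
  also have "(\<Sum>m\<le>k. qbinom fps_X k m * s m) = (\<Prod>j<k. ?v + ?u * ?w * fps_X ^ (n - j))"
    unfolding s_def by (rule q_vandermonde) (use assms in auto)
  also have "?c * \<dots> = pos_num n k u v w"
    by (simp add: pos_num_def)
  finally have sum: "(\<Sum>m\<le>k. ?t m) * pos_den n k u = pos_num n k u v w" .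
  show ?thesis
    unfolding sum[symmetric] by (rule nonzero_mult_div_cancel_right[OF pos_den_neq_0[OF assms]])
qed

text \<open>Both sides satisfy the same recurrence and agree for smaller \<open>k\<close>, so their
  difference satisfies \<open>d v w = c * d w v\<close>. Applying this twice gives
  \<open>(1 - c * c) * d v w = 0\<close>, and \<open>1 - c * c\<close> has constant coefficient
  1.\<close>

lemma pos_gf_closed:
  assumes "k \<le> n"
  shows "pos_gf n k u v w = pos_num n k u v w / pos_den n k u"
  using assms
proof (induction k arbitrary: v w rule: less_induct)
  case (less k)
  show ?case
  proof (cases "k = 0")
    case True
    thus ?thesis by (simp add: pos_gf_0 pos_num_def pos_den_def numeral_2_eq_2)
  next
    case False
    define d where "d v w = pos_gf n k u v w - pos_num n k u v w / pos_den n k u" for v w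
    define c :: "'a fps" where "c = fps_const (u ^ k) * fps_X ^ (\<Sum>j<k. n - j)"
    have d: "d v w = c * d w v" for v w
    proof -
      have "{..k} = insert k {..<k}" by auto
      thus ?thesis
        unfolding d_def c_def
        by (subst pos_gf_rec[OF less.prems], subst pos_gf_rec_closed[OF less.prems])
           (use less in \<open>simp add: algebra_simps numeral_2_eq_2\<close>)
    qed
    \<comment> \<open>The summand at \<open>j = 0\<close> is \<open>n\<close>, which is positive
      because \<open>0 < k \<le> n\<close>; hence \<open>c\<close> has constant coefficient
      0.\<close>
    have "n - 0 \<le> (\<Sum>j<k. n - j)"
      using False by (intro member_le_sum) auto
    then obtain s where "(\<Sum>j<k. n - j) = Suc s"
      using False less.prems by (cases "\<Sum>j<k. n - j") auto
    hence "fps_nth (1 - c * c) 0 = 1"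
      by (simp add: c_def)
    hence "1 - c * c \<noteq> 0" by (metis fps_zero_nth zero_neq_one)
    moreover have "(1 - c * c) * d v w = 0"
      using d[of v w] d[of w v] by (simp add: algebra_simps)
    ultimately show ?thesis by (simp add: d_def)
  qed
qed

section \<open>Translation into q-Pochhammer notation\<close>

text \<open>The exponents in \<open>pos_den\<close> decrease with the index while those of the
  Pochhammer product increase, so the product is reversed.\<close>

lemma pos_den_eq_q_pochhammer:
  assumes "m \<le> n"
  shows "pos_den n m u = q_pochhammer (fps_const (u\<^sup>2) * fps_X ^ (2 * n - m + 1)) fps_X m"
proof -
  have "q_pochhammer (fps_const (u\<^sup>2) * fps_X ^ (2 * n - m + 1)) fps_X m =
      (\<Prod>i<m. 1 - fps_const (u\<^sup>2) * fps_X ^ (2 * n - m + 1 + (m - Suc i)))"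
    unfolding q_pochhammer_def mult.assoc power_add[symmetric]
    by (rule prod.nat_diff_reindex[symmetric])
  also have "\<dots> = pos_den n m u"
    unfolding pos_den_def
  proof (intro prod.cong refl)
    fix i assume "i \<in> {..<m}"
    hence "2 * n - m + 1 + (m - Suc i) = n + n - i" using assms by simp
    thus "1 - fps_const (u\<^sup>2) * fps_X ^ (2 * n - m + 1 + (m - Suc i)) =
          1 - (fps_const u)\<^sup>2 * fps_X ^ (n + n - i)"
      by (simp only: fps_const_power)
  qed
  finally show ?thesis ..
qed

text \<open>The product is reversed again, and \<open>v\<close> is taken out of each of its
  \<open>m\<close> factors, which is where \<open>v \<noteq> 0\<close> enters.\<close>

lemma pos_num_eq_q_pochhammer:
  assumes "m \<le> n" "v \<noteq> 0"
  shows "pos_num n m u v 1 = fps_const ((u * v) ^ m) * fps_X ^ (m + 1 choose 2) * gauss_poly n m fps_X *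
           q_pochhammer (- (fps_const (u / v) * fps_X ^ (n - m + 1))) fps_X m"
proof -
  have "q_pochhammer (- (fps_const (u / v) * fps_X ^ (n - m + 1))) fps_X m =
      (\<Prod>i<m. 1 + fps_const (u / v) * fps_X ^ (n - m + 1 + i))"
    by (simp add: q_pochhammer_def power_add mult_ac)
  also have "\<dots> = (\<Prod>i<m. 1 + fps_const (u / v) * fps_X ^ (n - m + 1 + (m - Suc i)))"
    by (rule prod.nat_diff_reindex[symmetric])
  also have "\<dots> = (\<Prod>i<m. 1 + fps_const (u / v) * fps_X ^ (n - i))"
  proof (intro prod.cong refl)
    fix i assume "i \<in> {..<m}"
    hence "n - m + 1 + (m - Suc i) = n - i" using assms by simp
    thus "1 + fps_const (u / v) * fps_X ^ (n - m + 1 + (m - Suc i)) =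
          1 + fps_const (u / v) * fps_X ^ (n - i)" by (simp only:)
  qed
  finally have "fps_const (v ^ m) * q_pochhammer (- (fps_const (u / v) * fps_X ^ (n - m + 1))) fps_X m =
      (\<Prod>i<m. fps_const v) * (\<Prod>i<m. 1 + fps_const (u / v) * fps_X ^ (n - i))"
    by (simp add: fps_const_power)
  also have "\<dots> = (\<Prod>i<m. fps_const v + fps_const u * fps_const 1 * fps_X ^ (n - i))"
    unfolding prod.distrib[symmetric] using assms
    by (intro prod.cong refl) (simp add: distrib_left mult.assoc[symmetric])
  finally show ?thesis
    using assms by (simp add: pos_num_def gauss_poly_eq_qbinom power_mult_distrib mult_ac flip: fps_const_mult)
qed

theorem theorem1:
  fixes n k :: nat and u v :: "'a::field" and q :: "'a fps"
  assumes "k \<le> n" and "v \<noteq> 0" and "q = fps_X"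
  shows "truncated_lecture_hall_gf n k u v =
    (\<Sum>m=0..k. fps_const ((u * v) ^ m) * q ^ ((m + 1) choose 2) * gauss_poly n m q *
       (q_pochhammer (- (fps_const (u / v) * q ^ (n - m + 1))) q m /
        q_pochhammer (fps_const (u ^ 2) * q ^ (2 * n - m + 1)) q m))"
  unfolding truncated_lecture_hall_gf_eq[OF assms(1)] atLeast0AtMost assms(3)
proof (intro sum.cong refl)
  fix m assume "m \<in> {..k}"
  hence m: "m \<le> n" using assms(1) by simp
  \<comment> \<open>The denominator has constant coefficient 1, so division is multiplication by the
    inverse series and can be regrouped with the other factors.\<close>
  have "pos_gf n m u v 1 = pos_num n m u v 1 * inverse (pos_den n m u)"
    using pos_den_nth_0[OF m, of u] by (simp add: pos_gf_closed[OF m] fps_divide_unit)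
  thus "pos_gf n m u v 1 =
    fps_const ((u * v) ^ m) * fps_X ^ ((m + 1) choose 2) * gauss_poly n m fps_X *
       (q_pochhammer (- (fps_const (u / v) * fps_X ^ (n - m + 1))) fps_X m /
        q_pochhammer (fps_const (u ^ 2) * fps_X ^ (2 * n - m + 1)) fps_X m)"
    unfolding pos_den_eq_q_pochhammer[OF m, symmetric] pos_num_eq_q_pochhammer[OF m assms(2)]
    using pos_den_nth_0[OF m, of u] by (simp add: fps_divide_unit mult.assoc)
qed

end
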